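(* Let $G$ be a connected graph and $H$ a graph, both with at least two vertices. Then $G[H]$ is well-dominated if and only if either (i) $G$ is well-dominated and $H$ is complete, or (ii) $G$ is complete and $H$ is well-dominated with $\gamma(H)=2$.
   Context: A graph is well-dominated if all its inclusion-minimal dominating sets have the same size. $\gamma$ is the domination number. The lexicographic product $G[H]$ has vertex set $V(G)\times V(H)$, with $(x_1,y_1)$ adjacent to $(x_2,y_2)$ iff $x_1x_2\in E(G)$, or $x_1=x_2$ and $y_1y_2\in E(H)$. *)

theory Defs
  imports "Graph_Theory.Graph_Theory"
begin

text \<open>
  A finite simple graph is a \<^locale>\<open>pair_graph\<close>: every edge \<open>uv\<close> is represented by
  the two arcs \<open>(u, v)\<close> and \<open>(v, u)\<close>.
\<close>

definition dominating_set :: "'a pair_pre_digraph \<Rightarrow> 'a set \<Rightarrow> bool" where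
  "dominating_set G D \<longleftrightarrow>
     D \<subseteq> pverts G \<and> (\<forall>v \<in> pverts G - D. \<exists>u \<in> D. (u, v) \<in> parcs G)"

definition minimal_dominating_set :: "'a pair_pre_digraph \<Rightarrow> 'a set \<Rightarrow> bool" where
  "minimal_dominating_set G D \<longleftrightarrow>
     dominating_set G D \<and> (\<forall>D'. D' \<subset> D \<longrightarrow> \<not> dominating_set G D')"

definition well_dominated :: "'a pair_pre_digraph \<Rightarrow> bool" where
  "well_dominated G \<longleftrightarrow>
     (\<forall>D D'. minimal_dominating_set G D \<longrightarrow> minimal_dominating_set G D' \<longrightarrow> card D = card D')"

definition domination_number :: "'a pair_pre_digraph \<Rightarrow> nat" where
  "domination_number G = Min (card ` {D. dominating_set G D})"

definition lex_product ::
  "'a pair_pre_digraph \<Rightarrow> 'b pair_pre_digraph \<Rightarrow> ('a \<times> 'b) pair_pre_digraph" where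
  "lex_product G H =
     \<lparr> pverts = pverts G \<times> pverts H,
       parcs = {((x\<^sub>1, y\<^sub>1), (x\<^sub>2, y\<^sub>2)) | x\<^sub>1 y\<^sub>1 x\<^sub>2 y\<^sub>2.
         (x\<^sub>1, y\<^sub>1) \<in> pverts G \<times> pverts H \<and> (x\<^sub>2, y\<^sub>2) \<in> pverts G \<times> pverts H \<and>
         ((x\<^sub>1, x\<^sub>2) \<in> parcs G \<or> x\<^sub>1 = x\<^sub>2 \<and> (y\<^sub>1, y\<^sub>2) \<in> parcs H)} \<rparr>"

text \<open>
  In the library, \<^term>\<open>complete_digraph n G\<close> says that \<open>G\<close> is a complete graph on exactly
  \<open>n\<close> vertices.
\<close>

definition complete_graph :: "'a pair_pre_digraph \<Rightarrow> bool" where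
  "complete_graph G \<longleftrightarrow> complete_digraph (card (pverts G)) (with_proj G)"

lemma pair_graph_lex_product:
  assumes "pair_graph G" and "pair_graph H"
  shows "pair_graph (lex_product G H)"
proof -
  interpret G: pair_graph G by fact
  interpret H: pair_graph H by fact
  have fin: "finite ((pverts G \<times> pverts H) \<times> (pverts G \<times> pverts H))"
    using G.pair_finite_verts H.pair_finite_verts by simp
  show ?thesis
  proof
    show "finite (parcs (lex_product G H))"
      by (rule finite_subset[OF _ fin]) (auto simp: lex_product_def)
    show "symmetric (with_proj (lex_product G H))"
      by (auto simp: symmetric_def sym_def lex_product_def
          dest: G.arcs_symmetric H.arcs_symmetric)
  qed (auto simp: lex_product_def G.pair_finite_verts H.pair_finite_verts
      dest: G.pair_no_loops H.pair_no_loops)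
qed

end

theory Submission
  imports Defs
begin

text \<open>
  If \<open>I\<close> is a maximal independent set of \<open>G\<close> and \<open>S\<close> a minimal dominating set of \<open>H\<close>, then
  \<open>I \<times> S\<close> is a minimal dominating set of \<open>G[H]\<close>; if \<open>T\<close> is a total dominating set of \<open>G\<close>, then
  \<open>T \<times> {y}\<close> dominates \<open>G[H]\<close>.  Suppose that \<open>G[H]\<close> is well-dominated and \<open>H\<close> is not complete,
  so that two nonadjacent vertices of \<open>H\<close> give an \<open>S\<close> with \<open>|S| \<ge> 2\<close>.  If \<open>G\<close> were not complete,
  it would contain an induced path \<open>x z x'\<close>.  Extend \<open>{x, x'}\<close> to a maximal independent set \<open>I\<close>;
  adding to \<open>I\<close> one neighbour of each of its vertices, with \<open>z\<close> serving both \<open>x\<close> and \<open>x'\<close>, gives a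
  total dominating set with fewer than \<open>2|I| \<le> |I \<times> S|\<close> vertices, a contradiction.  For complete \<open>G\<close>
  the minimal dominating sets of \<open>G[H]\<close> are those of \<open>H\<close> placed in one fibre and pairs of
  vertices in different fibres.  If \<open>H\<close> is complete, the vertices of one fibre are twins and the
  projection to \<open>G\<close> preserves minimal dominating sets.
\<close>

section \<open>Dominating sets\<close>

lemma dominating_setI:
  assumes "D \<subseteq> pverts G"
    and "\<And>v. v \<in> pverts G \<Longrightarrow> v \<notin> D \<Longrightarrow> \<exists>u\<in>D. (u, v) \<in> parcs G"
  shows "dominating_set G D"
  using assms by (auto simp: dominating_set_def)

lemma dominating_set_subset: "dominating_set G D \<Longrightarrow> D \<subseteq> pverts G"
  by (simp add: dominating_set_def)

lemma dominating_setD: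
  assumes "dominating_set G D" "v \<in> pverts G" "v \<notin> D"
  obtains u where "u \<in> D" "(u, v) \<in> parcs G"
  using assms by (auto simp: dominating_set_def)

lemma dominating_set_mono:
  assumes "dominating_set G D" "D \<subseteq> D'" "D' \<subseteq> pverts G"
  shows "dominating_set G D'"
  using assms by (fastforce simp: dominating_set_def)

lemma dominating_set_nonempty:
  assumes "dominating_set G D" "pverts G \<noteq> {}"
  shows "D \<noteq> {}"
  using assms by (auto simp: dominating_set_def)

text \<open>Domination passes to larger vertex sets and every proper subset of \<open>D\<close> lies
  in some \<open>D - {v}\<close>, so single deletions decide minimality.\<close>

lemma minimal_dominating_setI:
  assumes "dominating_set G D" and "\<And>v. v \<in> D \<Longrightarrow> \<not> dominating_set G (D - {v})"
  shows "minimal_dominating_set G D"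
  unfolding minimal_dominating_set_def
proof (intro conjI allI impI notI)
  fix D' assume D': "D' \<subset> D" "dominating_set G D'"
  then obtain v where "v \<in> D" "v \<notin> D'" by blast
  with D' have "dominating_set G (D - {v})"
    using assms(1) by (intro dominating_set_mono[OF D'(2)]) (auto simp: dominating_set_def)
  with assms(2) \<open>v \<in> D\<close> show False by blast
qed (fact assms(1))

lemma minimal_dominating_set_dominating: "minimal_dominating_set G D \<Longrightarrow> dominating_set G D"
  by (simp add: minimal_dominating_set_def)

lemma minimal_dominating_set_eq:
  assumes "minimal_dominating_set G D" "dominating_set G D'" "D' \<subseteq> D"
  shows "D' = D"
  using assms by (auto simp: minimal_dominating_set_def)

lemma dominating_set_finite:
  assumes "finite (pverts G)" "dominating_set G D"
  shows "finite D"
  using assms by (auto simp: dominating_set_def intro: finite_subset)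

lemma dominating_set_contains_minimal:
  assumes "finite (pverts G)" "dominating_set G D"
  obtains M where "M \<subseteq> D" "minimal_dominating_set G M"
proof -
  let ?F = "{M. M \<subseteq> D \<and> dominating_set G M}"
  have "finite ?F"
    using dominating_set_finite[OF assms] by simp
  moreover have "?F \<noteq> {}" using assms by auto
  ultimately obtain M where M: "M \<in> ?F" "\<And>M'. M' \<in> ?F \<Longrightarrow> M' \<subseteq> M \<Longrightarrow> M = M'"
    using finite_has_minimal[of ?F] by metis
  have "minimal_dominating_set G M"
    unfolding minimal_dominating_set_def using M by blast
  with M that show thesis by blast
qed

text \<open>\<open>D'\<close> contains a minimal dominating set, and that one has the size of
  \<open>D\<close>. Hence any dominating set, minimal or not, bounds the common size from
  above.\<close>

lemma well_dominated_card_le: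
  assumes "finite (pverts G)" "well_dominated G" "minimal_dominating_set G D" "dominating_set G D'"
  shows "card D \<le> card D'"
proof -
  obtain M where M: "M \<subseteq> D'" "minimal_dominating_set G M"
    using dominating_set_contains_minimal assms(1,4) by metis
  then have "card D = card M" using assms(2,3) unfolding well_dominated_def by blast
  also have "card M \<le> card D'"
    using M dominating_set_finite[OF assms(1,4)] by (simp add: card_mono)
  finally show ?thesis .
qed

lemma domination_number_well_dominated:
  assumes "finite (pverts G)" "well_dominated G" "minimal_dominating_set G D"
  shows "domination_number G = card D"
  unfolding domination_number_def
proof (rule Min_eqI)
  have "{D. dominating_set G D} \<subseteq> Pow (pverts G)" by (auto simp: dominating_set_def)
  then show "finite (card ` {D. dominating_set G D})"
    using assms(1) by (meson finite_Pow_iff finite_imageI finite_subset)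
  show "card D \<in> card ` {D. dominating_set G D}"
    using assms(3) by (auto simp: minimal_dominating_set_def)
qed (use well_dominated_card_le[OF assms] in auto)

section \<open>Independent sets\<close>

text \<open>The case \<open>u = v\<close> is included, so independence excludes loops by itself and
  can be used where \<open>G\<close> is not assumed to be loopless.\<close>

definition independent_set :: "'a pair_pre_digraph \<Rightarrow> 'a set \<Rightarrow> bool" where
  "independent_set G I \<longleftrightarrow> I \<subseteq> pverts G \<and> (\<forall>u\<in>I. \<forall>v\<in>I. (u, v) \<notin> parcs G)"

text \<open>By finiteness there is a maximal independent set above \<open>A\<close>; it dominates,
  since an undominated vertex could be added to it.\<close>

lemma independent_set_extends_to_dominating:
  assumes "pair_graph G" "independent_set G A"
  obtains I where "A \<subseteq> I" "independent_set G I" "dominating_set G I"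
proof -
  interpret pair_graph G by fact
  let ?F = "{I. A \<subseteq> I \<and> independent_set G I}"
  have "?F \<subseteq> Pow (pverts G)" by (auto simp: independent_set_def)
  then have "finite ?F" using pair_finite_verts by (meson finite_Pow_iff finite_subset)
  moreover have "?F \<noteq> {}" using assms by auto
  ultimately obtain I where I: "I \<in> ?F" "\<And>J. J \<in> ?F \<Longrightarrow> I \<subseteq> J \<Longrightarrow> I = J"
    using finite_has_maximal[of ?F] by metis
  have "dominating_set G I"
  proof (rule dominating_setI)
    fix v assume v: "v \<in> pverts G" "v \<notin> I"
    show "\<exists>u\<in>I. (u, v) \<in> parcs G"
    proof (rule ccontr)
      assume "\<not> ?thesis"
      then have "independent_set G (insert v I)"
        using I(1) v pair_no_loops[of "(v, v)"]
        by (auto simp: independent_set_def dest: arcs_symmetric)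
      with I v show False by blast
    qed
  qed (use I in \<open>auto simp: independent_set_def\<close>)
  with I that show thesis by blast
qed

text \<open>Once \<open>v\<close> is deleted, no remaining vertex is adjacent to \<open>v\<close>,
  so \<open>v\<close> itself is undominated.\<close>

lemma independent_dominating_set_minimal:
  assumes "independent_set G I" "dominating_set G I"
  shows "minimal_dominating_set G I"
  using assms(2)
proof (rule minimal_dominating_setI)
  fix v assume "v \<in> I"
  with assms(1) show "\<not> dominating_set G (I - {v})"
    by (auto simp: independent_set_def dominating_set_def)
qed

section \<open>Complete and connected graphs\<close>

lemma complete_graph_iff:
  assumes "pair_graph G"
  shows "complete_graph G \<longleftrightarrow> (\<forall>u\<in>pverts G. \<forall>v\<in>pverts G. u \<noteq> v \<longrightarrow> (u, v) \<in> parcs G)"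
proof -
  interpret pair_graph G by fact
  show ?thesis
    unfolding complete_graph_def complete_digraph_pair_def
    using pair_finite_verts by (auto dest: in_arcsD1 in_arcsD2 pair_no_loops)
qed

text \<open>Connectedness is defined through the symmetric closure, which for a
  \<open>pair_graph\<close> is the graph itself.\<close>

lemma connected_imp_reachable:
  assumes "pair_graph G" "Digraph_Component.connected (with_proj G)" "u \<in> pverts G" "v \<in> pverts G"
  shows "(u, v) \<in> rtrancl_on (pverts G) (parcs G)"
proof -
  interpret pair_graph G by fact
  have "mk_symmetric (with_proj G) = G"
    by (rule pair_pre_digraph.equality) (auto simp: mk_symmetric_def dest: arcs_symmetric)
  then show ?thesis
    using assms by (auto simp: Digraph_Component.connected_def strongly_connected_def reachable_def)
qed

text \<open>Without such a path, being equal or adjacent is a transitive relation, so reachability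
  collapses to it and the graph is complete.\<close>

lemma connected_not_complete_induced_path:
  assumes "pair_graph G" "Digraph_Component.connected (with_proj G)" "\<not> complete_graph G"
  obtains x z x' where "(x, z) \<in> parcs G" "(z, x') \<in> parcs G" "x \<noteq> x'" "(x, x') \<notin> parcs G"
proof (rule ccontr)
  note path = that
  assume no_path: "\<not> thesis"
  have trans: "(x, x') \<in> parcs G"
    if "(x, z) \<in> parcs G" "(z, x') \<in> parcs G" "x \<noteq> x'" for x z x'
    using that no_path path by blast
  have "u = v \<or> (u, v) \<in> parcs G" if "(u, v) \<in> rtrancl_on (pverts G) (parcs G)" for u v
    using that by (induction rule: rtrancl_on_induct) (auto dest: trans)
  then have "complete_graph G"
    using connected_imp_reachable[OF assms(1,2)] by (auto simp: complete_graph_iff[OF assms(1)])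
  with assms(3) show False by simp
qed

lemma connected_has_neighbour:
  assumes "pair_graph G" "Digraph_Component.connected (with_proj G)" "card (pverts G) \<ge> 2"
    and "v \<in> pverts G"
  obtains u where "(v, u) \<in> parcs G"
proof -
  interpret pair_graph G by fact
  have "\<not> card (pverts G) \<le> Suc 0" using assms(3) by simp
  then obtain w where w: "w \<in> pverts G" "w \<noteq> v"
    using card_le_Suc0_iff_eq[OF pair_finite_verts] by metis
  have "(v, w) \<in> rtrancl_on (pverts G) (parcs G)"
    using connected_imp_reachable assms w by metis
  then show thesis
    using w that by (cases rule: converse_rtrancl_on_cases) auto
qed

section \<open>Dominating sets of lexicographic products\<close>

lemma pverts_lex_product [simp]: "pverts (lex_product G H) = pverts G \<times> pverts H"
  by (simp add: lex_product_def)

lemma parcs_lex_product_iff: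
  "((x, y), (x', y')) \<in> parcs (lex_product G H) \<longleftrightarrow>
    x \<in> pverts G \<and> y \<in> pverts H \<and> x' \<in> pverts G \<and> y' \<in> pverts H \<and>
    ((x, x') \<in> parcs G \<or> x = x' \<and> (y, y') \<in> parcs H)"
  by (auto simp: lex_product_def)

text \<open>Fibres over \<open>I\<close> are dominated from within by copies of \<open>S\<close>,
  all others from a neighbouring fibre over \<open>I\<close>. Independence of \<open>I\<close> keeps
  the copies of \<open>S\<close> from helping each other, so none can lose a vertex.\<close>

lemma lex_product_minimal_dominating_set_Times:
  assumes "independent_set G I" "dominating_set G I" "minimal_dominating_set H S"
    and "pverts H \<noteq> {}"
  shows "minimal_dominating_set (lex_product G H) (I \<times> S)"
proof (rule minimal_dominating_setI)
  have I: "I \<subseteq> pverts G" using assms(2) by (rule dominating_set_subset)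
  have S: "dominating_set H S" using assms(3) by (rule minimal_dominating_set_dominating)
  have S': "S \<subseteq> pverts H" using S by (rule dominating_set_subset)
  obtain s where s: "s \<in> S" using dominating_set_nonempty[OF S assms(4)] by blast
  show "dominating_set (lex_product G H) (I \<times> S)"
  proof (rule dominating_setI)
    fix v assume "v \<in> pverts (lex_product G H)" and nv: "v \<notin> I \<times> S"
    then obtain x y where v: "v = (x, y)" "x \<in> pverts G" "y \<in> pverts H" by auto
    show "\<exists>u\<in>I \<times> S. (u, v) \<in> parcs (lex_product G H)"
    proof (cases "x \<in> I")
      case True
      then have "y \<notin> S" using nv v by simp
      then obtain t where "t \<in> S" "(t, y) \<in> parcs H"
        using dominating_setD[OF S v(3)] by blast
      then have "((x, t), v) \<in> parcs (lex_product G H)"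
        using v S' by (auto simp: parcs_lex_product_iff)
      then show ?thesis using True \<open>t \<in> S\<close> by blast
    next
      case False
      then obtain w where "w \<in> I" "(w, x) \<in> parcs G"
        using dominating_setD[OF assms(2) v(2)] by blast
      then have "((w, s), v) \<in> parcs (lex_product G H)"
        using v S' I s by (auto simp: parcs_lex_product_iff)
      then show ?thesis using \<open>w \<in> I\<close> s by blast
    qed
  qed (use I S' in auto)
  fix v assume "v \<in> I \<times> S"
  then obtain x t where v: "v = (x, t)" "x \<in> I" "t \<in> S" by auto
  have "\<not> dominating_set H (S - {t})"
    using assms(3) v(3) by (auto simp: minimal_dominating_set_def)
  \<comment> \<open>A vertex that \<open>S\<close> dominates only through \<open>t\<close>, possibly
    \<open>t\<close> itself.\<close>
  then obtain y where y: "y \<in> pverts H" "y \<notin> S - {t}" "\<And>u. u \<in> S - {t} \<Longrightarrow> (u, y) \<notin> parcs H"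
    using S' unfolding dominating_set_def by blast
  show "\<not> dominating_set (lex_product G H) (I \<times> S - {v})"
  proof
    assume "dominating_set (lex_product G H) (I \<times> S - {v})"
    moreover have "(x, y) \<in> pverts (lex_product G H)" "(x, y) \<notin> I \<times> S - {v}"
      using v y I by auto
    ultimately obtain u where u: "u \<in> I \<times> S - {v}" "(u, (x, y)) \<in> parcs (lex_product G H)"
      by (rule dominating_setD)
    obtain a b where ab: "u = (a, b)" by fastforce
    \<comment> \<open>Independence confines the dominator of \<open>(x, y)\<close> to the fibre over
      \<open>x\<close>, where the choice of \<open>y\<close> forbids it.\<close>
    have "(a, x) \<notin> parcs G"
      using u ab v assms(1) by (auto simp: independent_set_def)
    then have "a = x" "(b, y) \<in> parcs H" using u ab by (auto simp: parcs_lex_product_iff)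
    then show False using u ab v y by auto
  qed
qed

text \<open>An arc of \<open>G\<close> joins whole fibres, so one second coordinate is enough;
  totality also covers the fibres over \<open>T\<close> itself.\<close>

lemma lex_product_total_dominating_set_Times:
  assumes "T \<subseteq> pverts G" "y \<in> pverts H" "\<And>v. v \<in> pverts G \<Longrightarrow> \<exists>u\<in>T. (u, v) \<in> parcs G"
  shows "dominating_set (lex_product G H) (T \<times> {y})"
proof (rule dominating_setI)
  fix v assume "v \<in> pverts (lex_product G H)"
  then obtain a b where v: "v = (a, b)" "a \<in> pverts G" "b \<in> pverts H" by auto
  with assms(3) obtain u where "u \<in> T" "(u, a) \<in> parcs G" by blast
  then have "(u, y) \<in> T \<times> {y}" "((u, y), v) \<in> parcs (lex_product G H)"
    using v assms by (auto simp: parcs_lex_product_iff)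
  then show "\<exists>u\<in>T \<times> {y}. (u, v) \<in> parcs (lex_product G H)" by blast
qed (use assms in auto)

section \<open>Projection to the first factor\<close>

lemma dominating_set_fst_lex_product:
  assumes "dominating_set (lex_product G H) D" "pverts H \<noteq> {}"
  shows "dominating_set G (fst ` D)"
proof (rule dominating_setI)
  show "fst ` D \<subseteq> pverts G" using dominating_set_subset[OF assms(1)] by auto
  fix x assume x: "x \<in> pverts G" "x \<notin> fst ` D"
  obtain y where "y \<in> pverts H" using assms(2) by blast
  with x have "(x, y) \<in> pverts (lex_product G H)" "(x, y) \<notin> D" by force+
  with assms(1) obtain u where u: "u \<in> D" "(u, (x, y)) \<in> parcs (lex_product G H)"
    by (rule dominating_setD)
  then have "fst u \<in> fst ` D" by blast
  moreover have "(fst u, x) \<in> parcs G"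
    using u x calculation by (cases u) (auto simp: parcs_lex_product_iff)
  ultimately show "\<exists>w\<in>fst ` D. (w, x) \<in> parcs G" by blast
qed

lemma dominating_set_lex_product_complete:
  assumes "pair_graph H" "complete_graph H"
    and "D \<subseteq> pverts G \<times> pverts H" "dominating_set G (fst ` D)"
  shows "dominating_set (lex_product G H) D"
proof (rule dominating_setI)
  fix v assume "v \<in> pverts (lex_product G H)" and nv: "v \<notin> D"
  then obtain x y where v: "v = (x, y)" "x \<in> pverts G" "y \<in> pverts H" by auto
  have "\<exists>u\<in>fst ` D. u = x \<or> (u, x) \<in> parcs G"
    using assms(4) v(2) unfolding dominating_set_def by blast
  then obtain a b where ab: "(a, b) \<in> D" "a = x \<or> (a, x) \<in> parcs G" by auto
  then have "((a, b), v) \<in> parcs (lex_product G H)"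
    using v nv assms(2,3) by (auto simp: parcs_lex_product_iff complete_graph_iff[OF assms(1)])
  with ab show "\<exists>u\<in>D. (u, v) \<in> parcs (lex_product G H)" by blast
qed (use assms in auto)

text \<open>Domination depends only on the set of first coordinates. A minimal set therefore meets
  each fibre at most once, and minimality is that of the projection.\<close>

lemma minimal_dominating_set_lex_product_complete_iff:
  assumes "pair_graph H" "complete_graph H" "pverts H \<noteq> {}" "D \<subseteq> pverts G \<times> pverts H"
  shows "minimal_dominating_set (lex_product G H) D \<longleftrightarrow>
    inj_on fst D \<and> minimal_dominating_set G (fst ` D)"
proof -
  have dom: "dominating_set (lex_product G H) E \<longleftrightarrow> dominating_set G (fst ` E)" if "E \<subseteq> D" for E
    using that assms dominating_set_fst_lex_product[of G H E]
      dominating_set_lex_product_complete[of H E G] by blast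
  show ?thesis
  proof (intro iffI conjI)
    assume D: "minimal_dominating_set (lex_product G H) D"
    then have domD: "dominating_set G (fst ` D)"
      using dom minimal_dominating_set_dominating by blast
    have lift: "E = D" if "E \<subseteq> D" "dominating_set G (fst ` E)" for E
      using minimal_dominating_set_eq[OF D _ that(1)] dom[OF that(1)] that(2) by blast
    show "inj_on fst D"
    proof (rule inj_onI)
      fix p q assume pq: "p \<in> D" "q \<in> D" "fst p = fst q"
      show "p = q"
      proof (rule ccontr)
        assume "p \<noteq> q"
        with pq have "fst ` (D - {p}) = fst ` D" by (auto simp: image_iff)
        then have "D - {p} = D" using domD by (intro lift) auto
        with pq show False by blast
      qed
    qed
    show "minimal_dominating_set G (fst ` D)"
      unfolding minimal_dominating_set_def
    proof (intro conjI allI impI notI)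
      fix E assume E: "E \<subset> fst ` D" "dominating_set G E"
      \<comment> \<open>Every subset of the projection is the projection of a subset of
        \<open>D\<close>, so minimality of \<open>D\<close> applies.\<close>
      then obtain E' where E': "E' \<subseteq> D" "E = fst ` E'" by (meson psubset_imp_subset subset_imageE)
      with E lift have "E' = D" by blast
      with E E' show False by blast
    qed (fact domD)
  next
    assume D: "inj_on fst D \<and> minimal_dominating_set G (fst ` D)"
    show "minimal_dominating_set (lex_product G H) D"
      unfolding minimal_dominating_set_def
    proof (intro conjI allI impI notI)
      show "dominating_set (lex_product G H) D"
        using D dom minimal_dominating_set_dominating by blast
      fix E assume E: "E \<subset> D" "dominating_set (lex_product G H) E"
      then have "fst ` E = fst ` D"
        using D dom minimal_dominating_set_eq by (metis image_mono psubset_imp_subset)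
      then have "E = D" using D E by (metis inj_on_image_eq_iff psubset_imp_subset subset_refl)
      with E show False by blast
    qed
  qed
qed

section \<open>Fibres over a complete first factor\<close>

lemma dominating_set_lex_product_fibre_iff:
  assumes "pair_graph G" "complete_graph G" "x \<in> pverts G" "pverts H \<noteq> {}"
  shows "dominating_set (lex_product G H) ({x} \<times> S) \<longleftrightarrow> dominating_set H S"
proof
  interpret pair_graph G by fact
  \<comment> \<open>Without a loop at \<open>x\<close>, domination inside the fibre over
    \<open>x\<close> can only come from arcs of \<open>H\<close>.\<close>
  have nx: "(x, x) \<notin> parcs G" using pair_no_loops by fastforce
  assume dom: "dominating_set (lex_product G H) ({x} \<times> S)"
  show "dominating_set H S"
  proof (rule dominating_setI)
    fix y assume "y \<in> pverts H" "y \<notin> S"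
    with assms have "(x, y) \<in> pverts (lex_product G H)" "(x, y) \<notin> {x} \<times> S" by auto
    with dom obtain u where "u \<in> {x} \<times> S" "(u, (x, y)) \<in> parcs (lex_product G H)"
      by (rule dominating_setD)
    then show "\<exists>t\<in>S. (t, y) \<in> parcs H" using nx by (auto simp: parcs_lex_product_iff)
  qed (use dominating_set_subset[OF dom] in auto)
next
  assume S: "dominating_set H S"
  obtain s where s: "s \<in> S" using dominating_set_nonempty[OF S assms(4)] by blast
  have S': "S \<subseteq> pverts H" using S by (rule dominating_set_subset)
  show "dominating_set (lex_product G H) ({x} \<times> S)"
  proof (rule dominating_setI)
    fix v assume "v \<in> pverts (lex_product G H)" and nv: "v \<notin> {x} \<times> S"
    then obtain a b where v: "v = (a, b)" "a \<in> pverts G" "b \<in> pverts H" by auto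
    have "\<exists>t\<in>S. ((x, t), v) \<in> parcs (lex_product G H)"
    proof (cases "a = x")
      case True
      then obtain t where "t \<in> S" "(t, b) \<in> parcs H"
        using dominating_setD[OF S v(3)] nv v by blast
      then show ?thesis using True v S' assms by (auto simp: parcs_lex_product_iff)
    next
      case False
      \<comment> \<open>Every other fibre is completely joined to this one, so the single vertex
        \<open>(x, s)\<close> dominates it.\<close>
      then have "(x, a) \<in> parcs G" using assms(2,3) v by (simp add: complete_graph_iff[OF assms(1)])
      then show ?thesis using v s S' assms(3) by (auto simp: parcs_lex_product_iff)
    qed
    then show "\<exists>u\<in>{x} \<times> S. (u, v) \<in> parcs (lex_product G H)" by blast
  qed (use S' assms(3) in auto)
qed

lemma minimal_dominating_set_lex_product_fibre_iff:
  assumes "pair_graph G" "complete_graph G" "x \<in> pverts G" "pverts H \<noteq> {}"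
  shows "minimal_dominating_set (lex_product G H) ({x} \<times> S) \<longleftrightarrow> minimal_dominating_set H S"
proof -
  have sub: "(\<exists>T. D = {x} \<times> T \<and> T \<subset> S) \<longleftrightarrow> D \<subset> {x} \<times> S" for D
  proof
    assume D: "D \<subset> {x} \<times> S"
    then have "D = {x} \<times> snd ` D" by force
    with D show "\<exists>T. D = {x} \<times> T \<and> T \<subset> S" by blast
  qed auto
  show ?thesis
    unfolding minimal_dominating_set_def sub[symmetric]
    using dominating_set_lex_product_fibre_iff[OF assms] by blast
qed

text \<open>Each of the two vertices dominates all fibres other than its own, and the two fibres
  differ.\<close>

lemma dominating_set_lex_product_two_fibres:
  assumes "pair_graph G" "complete_graph G" "x \<in> pverts G" "x' \<in> pverts G" "x \<noteq> x'"
    and "y \<in> pverts H" "y' \<in> pverts H"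
  shows "dominating_set (lex_product G H) {(x, y), (x', y')}"
proof (rule dominating_setI)
  fix v assume "v \<in> pverts (lex_product G H)"
  then show "\<exists>u\<in>{(x, y), (x', y')}. (u, v) \<in> parcs (lex_product G H)"
    using assms by (cases v; cases "fst v = x") (auto simp: parcs_lex_product_iff complete_graph_iff)
qed (use assms in auto)

section \<open>Well-dominated lexicographic products\<close>

text \<open>Minimal dominating sets pass up by \<open>D \<times> {y}\<close> and down by
  \<open>fst\<close>; both maps preserve size.\<close>

lemma well_dominated_lex_product_complete_right:
  assumes "pair_graph H" "complete_graph H" "pverts H \<noteq> {}"
  shows "well_dominated (lex_product G H) \<longleftrightarrow> well_dominated G"
proof
  assume wd: "well_dominated (lex_product G H)"
  obtain y where y: "y \<in> pverts H" using assms(3) by blast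
  have "minimal_dominating_set (lex_product G H) (D \<times> {y})" if "minimal_dominating_set G D" for D
  proof -
    have "D \<subseteq> pverts G"
      using that minimal_dominating_set_dominating dominating_set_subset by blast
    moreover have "fst ` (D \<times> {y}) = D" by force
    ultimately show ?thesis
      using that y
      by (subst minimal_dominating_set_lex_product_complete_iff[OF assms]) (auto simp: inj_on_def)
  qed
  then show "well_dominated G"
    using wd unfolding well_dominated_def
    by (metis card_cartesian_product_singleton card_cartesian_product mult.commute)
next
  assume wd: "well_dominated G"
  have "card D = card (fst ` D) \<and> minimal_dominating_set G (fst ` D)"
    if "minimal_dominating_set (lex_product G H) D" for D
  proof -
    have "D \<subseteq> pverts G \<times> pverts H"
      using dominating_set_subset[OF minimal_dominating_set_dominating[OF that]] by simp
    then show ?thesis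
      using minimal_dominating_set_lex_product_complete_iff[OF assms] that by (metis card_image)
  qed
  then show "well_dominated (lex_product G H)"
    using wd unfolding well_dominated_def by metis
qed

section \<open>Second factor not complete\<close>

lemma not_complete_minimal_dominating_set:
  assumes "pair_graph H" "\<not> complete_graph H"
  obtains S where "minimal_dominating_set H S" "card S \<ge> 2"
proof -
  interpret pair_graph H by fact
  obtain u v where uv: "u \<in> pverts H" "v \<in> pverts H" "u \<noteq> v" "(u, v) \<notin> parcs H"
    using assms(2) by (auto simp: complete_graph_iff[OF assms(1)])
  then have "independent_set H {u, v}"
    by (auto simp: independent_set_def dest: arcs_symmetric pair_no_loops)
  then obtain S where S: "{u, v} \<subseteq> S" "independent_set H S" "dominating_set H S"
    using independent_set_extends_to_dominating[OF assms(1)] by metis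
  have "card {u, v} \<le> card S"
    using S dominating_set_finite[OF pair_finite_verts] by (intro card_mono) auto
  then show thesis
    using that independent_dominating_set_minimal[OF S(2,3)] uv(3) by simp
qed

text \<open>Vertices outside \<open>I\<close> already have a neighbour in \<open>I\<close>, so it
  suffices to add neighbours for the vertices of \<open>I\<close>; \<open>x\<close> and
  \<open>x'\<close> share \<open>z\<close>.\<close>

lemma induced_path_small_total_dominating_set:
  assumes "pair_graph G" "Digraph_Component.connected (with_proj G)" "card (pverts G) \<ge> 2"
    and path: "(x, z) \<in> parcs G" "(z, x') \<in> parcs G" "x \<noteq> x'"
    and I: "{x, x'} \<subseteq> I" "dominating_set G I"
  obtains T where "T \<subseteq> pverts G" "\<And>v. v \<in> pverts G \<Longrightarrow> \<exists>u\<in>T. (u, v) \<in> parcs G"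
    and "card T < 2 * card I"
proof -
  interpret pair_graph G by fact
  have IV: "I \<subseteq> pverts G" using I(2) by (rule dominating_set_subset)
  have "finite I" using dominating_set_finite[OF pair_finite_verts I(2)] .
  have "\<forall>v\<in>pverts G. \<exists>u. (v, u) \<in> parcs G"
    using connected_has_neighbour[OF assms(1-3)] by blast
  then obtain f where f: "\<And>v. v \<in> pverts G \<Longrightarrow> (v, f v) \<in> parcs G"
    by metis
  define R where "R = insert z (f ` (I - {x, x'}))"
  have "card {x, x'} \<le> card I" using I \<open>finite I\<close> by (intro card_mono) auto
  then have "card I \<ge> 2" using path by simp
  have "card R \<le> Suc (card (f ` (I - {x, x'})))"
    unfolding R_def by (rule card_insert_le_m1) auto
  also have "\<dots> \<le> Suc (card (I - {x, x'}))"
    using \<open>finite I\<close> by (simp add: card_image_le)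
  \<comment> \<open>Two vertices leave and only \<open>z\<close> comes in: this saving of one makes
    the final bound strict.\<close>
  also have "card (I - {x, x'}) = card I - 2"
    using I path \<open>finite I\<close> by (simp add: card_Diff_subset)
  finally have "card R < card I" using \<open>card I \<ge> 2\<close> by simp
  moreover have "card (I \<union> R) \<le> card I + card R" by (rule card_Un_le)
  ultimately have "card (I \<union> R) < 2 * card I" by simp
  moreover have "I \<union> R \<subseteq> pverts G"
    using IV f path by (auto simp: R_def dest: in_arcsD1 in_arcsD2)
  moreover have "\<exists>u\<in>I \<union> R. (u, v) \<in> parcs G" if v: "v \<in> pverts G" for v
  proof (cases "v \<in> I")
    case True
    show ?thesis
    proof (cases "v \<in> {x, x'}")
      case True
      then have "(z, v) \<in> parcs G" using path arcs_symmetric by blast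
      then show ?thesis by (auto simp: R_def)
    next
      case False
      have "(f v, v) \<in> parcs G" using f[OF v] arcs_symmetric by blast
      then show ?thesis using False \<open>v \<in> I\<close> by (auto simp: R_def)
    qed
  next
    case False
    then show ?thesis using dominating_setD[OF I(2) v] by blast
  qed
  ultimately show thesis using that by blast
qed

text \<open>Otherwise the minimal dominating set \<open>I \<times> S\<close> has at least
  \<open>2 * card I\<close> vertices, more than the dominating set
  \<open>T \<times> {y}\<close>.\<close>

lemma well_dominated_lex_product_imp_complete_left:
  assumes "pair_graph G" "Digraph_Component.connected (with_proj G)" "pair_graph H"
    and "card (pverts G) \<ge> 2" "pverts H \<noteq> {}"
    and "well_dominated (lex_product G H)" "\<not> complete_graph H"
  shows "complete_graph G"
proof (rule ccontr)
  interpret G: pair_graph G by fact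
  interpret H: pair_graph H by fact
  assume "\<not> complete_graph G"
  then obtain x z x' where
    path: "(x, z) \<in> parcs G" "(z, x') \<in> parcs G" "x \<noteq> x'" "(x, x') \<notin> parcs G"
    using connected_not_complete_induced_path[OF assms(1,2)] by metis
  then have "independent_set G {x, x'}"
    by (auto simp: independent_set_def
        dest: G.arcs_symmetric G.pair_no_loops G.in_arcsD1 G.in_arcsD2)
  then obtain I where I: "{x, x'} \<subseteq> I" "independent_set G I" "dominating_set G I"
    using independent_set_extends_to_dominating[OF assms(1)] by metis
  obtain T where T: "T \<subseteq> pverts G" "\<And>v. v \<in> pverts G \<Longrightarrow> \<exists>u\<in>T. (u, v) \<in> parcs G"
      "card T < 2 * card I"
    using induced_path_small_total_dominating_set[OF assms(1,2,4) path(1-3) I(1,3)] by metis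
  obtain S where S: "minimal_dominating_set H S" "card S \<ge> 2"
    using not_complete_minimal_dominating_set[OF assms(3,7)] .
  obtain y where y: "y \<in> pverts H" using assms(5) by blast
  have "card (I \<times> S) \<le> card (T \<times> {y})"
  proof (rule well_dominated_card_le[OF _ assms(6)])
    show "minimal_dominating_set (lex_product G H) (I \<times> S)"
      using lex_product_minimal_dominating_set_Times[OF I(2,3) S(1) assms(5)] .
    show "dominating_set (lex_product G H) (T \<times> {y})"
      using lex_product_total_dominating_set_Times[OF T(1) y T(2)] .
  qed (simp add: G.pair_finite_verts H.pair_finite_verts)
  then have "card I * card S \<le> card T" by (simp add: card_cartesian_product)
  moreover have "card I * 2 \<le> card I * card S" using S(2) by (rule mult_le_mono2)
  ultimately show False using T(3) by linarith
qed

lemma well_dominated_lex_product_complete_left: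
  assumes "pair_graph G" "pair_graph H" "complete_graph G"
    and "card (pverts G) \<ge> 2" "pverts H \<noteq> {}" "\<not> complete_graph H"
    and wd: "well_dominated (lex_product G H)"
  shows "well_dominated H \<and> domination_number H = 2"
proof -
  interpret G: pair_graph G by fact
  interpret H: pair_graph H by fact
  have "\<not> card (pverts G) \<le> Suc 0" using assms(4) by simp
  then obtain x x' where x: "x \<in> pverts G" "x' \<in> pverts G" "x \<noteq> x'"
    using card_le_Suc0_iff_eq[OF G.pair_finite_verts] by blast
  obtain y where y: "y \<in> pverts H" using assms(5) by blast
  note fibre = minimal_dominating_set_lex_product_fibre_iff[OF assms(1,3) x(1) assms(5)]
  have wdH: "well_dominated H"
    unfolding well_dominated_def
  proof (intro allI impI)
    fix S S' assume "minimal_dominating_set H S" "minimal_dominating_set H S'"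
    then have "card ({x} \<times> S) = card ({x} \<times> S')"
      using wd fibre unfolding well_dominated_def by blast
    then show "card S = card S'" by (simp add: card_cartesian_product)
  qed
  obtain S where S: "minimal_dominating_set H S" "card S \<ge> 2"
    using not_complete_minimal_dominating_set[OF assms(2,6)] .
  \<comment> \<open>A pair from two fibres bounds \<open>card S\<close> by 2 from above; the choice
    of \<open>S\<close> bounds it from below.\<close>
  have "card ({x} \<times> S) \<le> card {(x, y), (x', y)}"
    using S fibre dominating_set_lex_product_two_fibres[OF assms(1,3) x y y]
    by (intro well_dominated_card_le[OF _ wd])
      (auto simp: G.pair_finite_verts H.pair_finite_verts)
  then have "card S = 2" using S(2) x(3) by (simp add: card_cartesian_product)
  then show ?thesis
    using wdH domination_number_well_dominated[OF H.pair_finite_verts wdH S(1)] by simp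
qed

text \<open>If \<open>D\<close> meets two fibres, one vertex from each already dominates, so
  \<open>D\<close> is that pair. Otherwise \<open>D\<close> is a copy of a minimal dominating set of
  \<open>H\<close>, of size \<open>domination_number H\<close>.\<close>

lemma minimal_dominating_set_lex_product_complete_left_card:
  assumes "pair_graph G" "pair_graph H" "complete_graph G" "pverts G \<noteq> {}" "pverts H \<noteq> {}"
    and H: "well_dominated H" "domination_number H = 2"
    and D: "minimal_dominating_set (lex_product G H) D"
  shows "card D = 2"
proof -
  interpret H: pair_graph H by fact
  have domD: "dominating_set (lex_product G H) D"
    using D by (rule minimal_dominating_set_dominating)
  have DV: "D \<subseteq> pverts G \<times> pverts H" using dominating_set_subset[OF domD] by simp
  obtain x y where xy: "(x, y) \<in> D"
    using dominating_set_nonempty[OF domD] assms(4,5) by fastforce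
  show ?thesis
  proof (cases "\<exists>x' y'. (x', y') \<in> D \<and> x' \<noteq> x")
    case True
    then obtain x' y' where xy': "(x', y') \<in> D" "x' \<noteq> x" by blast
    then have "dominating_set (lex_product G H) {(x, y), (x', y')}"
      using xy DV by (intro dominating_set_lex_product_two_fibres[OF assms(1,3)]) auto
    then have "D = {(x, y), (x', y')}"
      using minimal_dominating_set_eq[OF D] xy xy' by blast
    then show ?thesis using xy'(2) by simp
  next
    case False
    then have Deq: "D = {x} \<times> snd ` D" by force
    have "x \<in> pverts G" using xy DV by blast
    then have "minimal_dominating_set H (snd ` D)"
      using minimal_dominating_set_lex_product_fibre_iff[OF assms(1,3) _ assms(5)] D Deq by metis
    then have "card (snd ` D) = 2"
      using domination_number_well_dominated[OF H.pair_finite_verts H(1)] H(2) by simp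
    then show ?thesis using Deq by (metis card_cartesian_product_singleton)
  qed
qed

theorem theorem12:
  fixes G :: "'a pair_pre_digraph" and H :: "'b pair_pre_digraph"
  assumes "pair_graph G" and "Digraph_Component.connected (with_proj G)" and "pair_graph H"
    and "card (pverts G) \<ge> 2" and "card (pverts H) \<ge> 2"
  shows "well_dominated (lex_product G H) \<longleftrightarrow>
    (well_dominated G \<and> complete_graph H) \<or>
    (complete_graph G \<and> well_dominated H \<and> domination_number H = 2)"
proof -
  have ne: "pverts G \<noteq> {}" "pverts H \<noteq> {}" using assms(4,5) by auto
  have "well_dominated (lex_product G H)"
    if "complete_graph G" "well_dominated H" "domination_number H = 2"
    using minimal_dominating_set_lex_product_complete_left_card[OF assms(1,3) that(1) ne that(2,3)]
    by (simp add: well_dominated_def)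
  moreover have "complete_graph G \<and> well_dominated H \<and> domination_number H = 2"
    if "well_dominated (lex_product G H)" "\<not> complete_graph H"
    using well_dominated_lex_product_imp_complete_left[OF assms(1-4) ne(2) that]
      well_dominated_lex_product_complete_left[OF assms(1,3) _ assms(4) ne(2) that(2,1)] by blast
  \<comment> \<open>Case distinction on completeness of \<open>H\<close>: if it is complete, the
    product is well-dominated exactly when \<open>G\<close> is; if not, only the second alternative
    remains.\<close>
  ultimately show ?thesis
    using well_dominated_lex_product_complete_right[OF assms(3) _ ne(2)] by blast
qed

end
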